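(* The axiomatization consisting of A1-4, IF1 and IF2 is sound and ground-complete for BCCSP($A$) modulo $\precsim_{\rm IF}$.
   Context: $A$ is a nonempty countable set of actions. BCCSP($A$) terms: $t::=0\mid x\mid at\mid t+t$ ($x$ a variable, $a\in A$); closed terms contain no variables. Transitions: $at\xrightarrow{a}t$; if $t\xrightarrow{a}t'$ then $t+u\xrightarrow{a}t'$ and $u+t\xrightarrow{a}t'$. $a_1\cdots a_k$ is a trace of $s$ if $s\xrightarrow{a_1}\cdots\xrightarrow{a_k}s'$ for some $s'$; $\mathcal{T}(s)$ is the set of traces. $(a_1\cdots a_k,B)$ with $B\subseteq A^*$ is an impossible future of $s$ if $s\xrightarrow{a_1}\cdots\xrightarrow{a_k}s'$ with $\mathcal{T}(s')\cap B=\emptyset$. $s_1\precsim_{\rm IF}s_2$ iff every impossible future of $s_1$ is one of $s_2$; on open terms via all closed substitutions. Inequational logic (reflexivity, transitivity, substitution instances, closure under contexts; an equation abbreviates two inequations). Sound: derivable inequations hold modulo $\precsim_{\rm IF}$; ground-complete: closed $p\precsim_{\rm IF}q$ implies $p\preccurlyeq q$ derivable. Axioms (action $a$ ranges over $A$): A1: $x+y\approx y+x$; A2: $(x+y)+z\approx x+(y+z)$; A3: $x+x\approx x$; A4: $x+0\approx x$; IF1: $a(x+y)\preccurlyeq ax+ay$; IF2: $ax+a(y+z)\approx a(x+y)+ax+a(y+z)$. *)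

theory Defs
  imports Main "HOL-Library.Countable"
begin

datatype 'a bccsp =
    Zero
  | Var nat
  | Pref 'a "'a bccsp"  (infixr "\<cdot>" 75)
  | Alt "'a bccsp" "'a bccsp"  (infixl "\<oplus>" 65)

primrec vars :: "'a bccsp \<Rightarrow> nat set" where
  "vars Zero = {}"
| "vars (Var x) = {x}"
| "vars (a \<cdot> t) = vars t"
| "vars (t \<oplus> u) = vars t \<union> vars u"

definition closed_term :: "'a bccsp \<Rightarrow> bool" where
  "closed_term t \<longleftrightarrow> vars t = {}"

primrec subst :: "(nat \<Rightarrow> 'a bccsp) \<Rightarrow> 'a bccsp \<Rightarrow> 'a bccsp" where
  "subst \<sigma> Zero = Zero"
| "subst \<sigma> (Var x) = \<sigma> x"
| "subst \<sigma> (a \<cdot> t) = a \<cdot> subst \<sigma> t"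
| "subst \<sigma> (t \<oplus> u) = subst \<sigma> t \<oplus> subst \<sigma> u"

definition closed_subst :: "(nat \<Rightarrow> 'a bccsp) \<Rightarrow> bool" where
  "closed_subst \<sigma> \<longleftrightarrow> (\<forall>x. closed_term (\<sigma> x))"

inductive step :: "'a bccsp \<Rightarrow> 'a \<Rightarrow> 'a bccsp \<Rightarrow> bool" where
  step_Pref: "step (a \<cdot> t) a t"
| step_Alt1: "step t a t' \<Longrightarrow> step (t \<oplus> u) a t'"
| step_Alt2: "step t a t' \<Longrightarrow> step (u \<oplus> t) a t'"

inductive steps :: "'a bccsp \<Rightarrow> 'a list \<Rightarrow> 'a bccsp \<Rightarrow> bool" where
  steps_Nil: "steps s [] s"
| steps_Cons: "step s a s' \<Longrightarrow> steps s' w s'' \<Longrightarrow> steps s (a # w) s''"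

definition traces :: "'a bccsp \<Rightarrow> 'a list set" where
  "traces s = {w. \<exists>s'. steps s w s'}"

definition impossible_futures :: "'a bccsp \<Rightarrow> ('a list \<times> 'a list set) set" where
  "impossible_futures s = {(w, B). \<exists>s'. steps s w s' \<and> traces s' \<inter> B = {}}"

text \<open>\<open>IF_le\<close> is meant for closed terms; \<open>IF_le_open\<close> is its extension to open terms.\<close>

definition IF_le :: "'a bccsp \<Rightarrow> 'a bccsp \<Rightarrow> bool" where
  "IF_le s1 s2 \<longleftrightarrow> impossible_futures s1 \<subseteq> impossible_futures s2"

definition IF_le_open :: "'a bccsp \<Rightarrow> 'a bccsp \<Rightarrow> bool" where
  "IF_le_open t u \<longleftrightarrow> (\<forall>\<sigma>. closed_subst \<sigma> \<longrightarrow> IF_le (subst \<sigma> t) (subst \<sigma> u))"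

text \<open>A pair \<open>(t, u)\<close> in an axiom set stands for the inequation \<open>t \<preceq> u\<close>.\<close>

inductive derivable :: "('a bccsp \<times> 'a bccsp) set \<Rightarrow> 'a bccsp \<Rightarrow> 'a bccsp \<Rightarrow> bool"
  for E where
  derivable_axiom: "(t, u) \<in> E \<Longrightarrow> derivable E t u"
| derivable_refl: "derivable E t t"
| derivable_trans: "derivable E t u \<Longrightarrow> derivable E u v \<Longrightarrow> derivable E t v"
| derivable_subst: "derivable E t u \<Longrightarrow> derivable E (subst \<sigma> t) (subst \<sigma> u)"
| derivable_Pref: "derivable E t u \<Longrightarrow> derivable E (a \<cdot> t) (a \<cdot> u)"
| derivable_Alt1: "derivable E t u \<Longrightarrow> derivable E (t \<oplus> v) (u \<oplus> v)"
| derivable_Alt2: "derivable E t u \<Longrightarrow> derivable E (v \<oplus> t) (v \<oplus> u)"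

definition sound :: "('a bccsp \<times> 'a bccsp) set \<Rightarrow> bool" where
  "sound E \<longleftrightarrow> (\<forall>t u. derivable E t u \<longrightarrow> IF_le_open t u)"

definition ground_complete :: "('a bccsp \<times> 'a bccsp) set \<Rightarrow> bool" where
  "ground_complete E \<longleftrightarrow>
     (\<forall>p q. closed_term p \<longrightarrow> closed_term q \<longrightarrow> IF_le p q \<longrightarrow> derivable E p q)"

definition equation :: "'a bccsp \<Rightarrow> 'a bccsp \<Rightarrow> ('a bccsp \<times> 'a bccsp) set" where
  "equation t u = {(t, u), (u, t)}"

abbreviation X :: "'a bccsp" where "X \<equiv> Var 0"
abbreviation Y :: "'a bccsp" where "Y \<equiv> Var 1"
abbreviation Z :: "'a bccsp" where "Z \<equiv> Var 2"

definition A1 :: "('a bccsp \<times> 'a bccsp) set" where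
  "A1 = equation (X \<oplus> Y) (Y \<oplus> X)"

definition A2 :: "('a bccsp \<times> 'a bccsp) set" where
  "A2 = equation ((X \<oplus> Y) \<oplus> Z) (X \<oplus> (Y \<oplus> Z))"

definition A3 :: "('a bccsp \<times> 'a bccsp) set" where
  "A3 = equation (X \<oplus> X) X"

definition A4 :: "('a bccsp \<times> 'a bccsp) set" where
  "A4 = equation (X \<oplus> Zero) X"

definition IF1 :: "('a bccsp \<times> 'a bccsp) set" where
  "IF1 = (\<Union>a. {(a \<cdot> (X \<oplus> Y), a \<cdot> X \<oplus> a \<cdot> Y)})"

definition IF2 :: "('a bccsp \<times> 'a bccsp) set" where
  "IF2 = (\<Union>a. equation (a \<cdot> X \<oplus> a \<cdot> (Y \<oplus> Z))
                       (a \<cdot> (X \<oplus> Y) \<oplus> a \<cdot> X \<oplus> a \<cdot> (Y \<oplus> Z)))"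

end

theory Submission
  imports Defs
begin

text \<open>
  Semantically, \<open>p\<close> is below \<open>q\<close> iff every \<open>w\<close>-derivative \<open>p'\<close> of \<open>p\<close> is matched by a
  \<open>w\<close>-derivative \<open>q'\<close> of \<open>q\<close> with fewer traces; the empty \<open>w\<close> yields \<open>traces q \<subseteq> traces p\<close>.

  Ground-completeness goes through \<open>p \<preceq> p + q \<preceq> q\<close>. By IF2, a term \<open>p\<close> with \<open>a\<close>-derivatives
  absorbs \<open>a s\<close>, where \<open>s\<close> is the sum of all of them. Then \<open>p \<preceq> p + a q'\<close> whenever the traces of
  \<open>a q'\<close> are traces of \<open>p\<close>, because inductively \<open>a s \<preceq> a (s + q') \<preceq> a s + a q'\<close> by IF1.
  Conversely, if \<open>a p'\<close> is matched by \<open>q\<close>, let \<open>s\<close> be the sum of the \<open>a\<close>-derivatives of \<open>q\<close>, and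
  let \<open>q0\<close> be one of them with \<open>traces q0 \<subseteq> traces p'\<close>. Then
  \<open>q + a p' \<preceq> q + a (s + p') + a (p' + q0) \<preceq> q + a (s + p') \<preceq> q + a s \<preceq> q\<close>, where the second step
  is IF2 and the third is the induction hypothesis for the summands of \<open>p'\<close>.
\<close>

section \<open>Transitions and traces\<close>

lemma step_simps [simp]:
  "\<not> step Zero a s"
  "\<not> step (Var x) a s"
  "step (b \<cdot> t) a s \<longleftrightarrow> a = b \<and> s = t"
  "step (t \<oplus> u) a s \<longleftrightarrow> step t a s \<or> step u a s"
  by (auto elim: step.cases intro: step.intros)

lemma steps_simps [simp]:
  "steps s [] s' \<longleftrightarrow> s' = s"
  "steps s (a # w) s' \<longleftrightarrow> (\<exists>s1. step s a s1 \<and> steps s1 w s')"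
  by (auto elim: steps.cases intro: steps.intros)

lemma traces_iff:
  "[] \<in> traces s"
  "a # w \<in> traces s \<longleftrightarrow> (\<exists>s'. step s a s' \<and> w \<in> traces s')"
proof -
  have "steps s [] s" by simp
  then show "[] \<in> traces s" unfolding traces_def by blast
  show "a # w \<in> traces s \<longleftrightarrow> (\<exists>s'. step s a s' \<and> w \<in> traces s')"
    unfolding traces_def mem_Collect_eq steps_simps by blast
qed

lemma traces_Alt [simp]: "traces (t \<oplus> u) = traces t \<union> traces u"
proof (rule set_eqI)
  show "w \<in> traces (t \<oplus> u) \<longleftrightarrow> w \<in> traces t \<union> traces u" for w
    by (cases w) (auto simp: traces_iff)
qed

lemma traces_Pref [simp]: "traces (a \<cdot> t) = insert [] ((#) a ` traces t)"
proof (rule set_eqI)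
  show "w \<in> traces (a \<cdot> t) \<longleftrightarrow> w \<in> insert [] ((#) a ` traces t)" for w
    by (cases w) (auto simp: traces_iff)
qed

text \<open>Taking \<open>B = - traces p'\<close> records the largest set that \<open>p'\<close>
  avoids, and a match for it is exactly a \<open>q'\<close> with
  \<open>traces q' \<subseteq> traces p'\<close>. Such a \<open>q'\<close> then avoids every other
  \<open>B\<close> that \<open>p'\<close> avoids.\<close>

lemma IF_le_iff:
  "IF_le p q \<longleftrightarrow> (\<forall>w p'. steps p w p' \<longrightarrow> (\<exists>q'. steps q w q' \<and> traces q' \<subseteq> traces p'))"
proof
  assume le: "IF_le p q"
  show "\<forall>w p'. steps p w p' \<longrightarrow> (\<exists>q'. steps q w q' \<and> traces q' \<subseteq> traces p')"
  proof (intro allI impI)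
    fix w p' assume "steps p w p'"
    then have "(w, - traces p') \<in> impossible_futures p"
      by (auto simp: impossible_futures_def)
    then have "(w, - traces p') \<in> impossible_futures q"
      using le by (auto simp: IF_le_def)
    then show "\<exists>q'. steps q w q' \<and> traces q' \<subseteq> traces p'"
      by (auto simp: impossible_futures_def)
  qed
next
  assume "\<forall>w p'. steps p w p' \<longrightarrow> (\<exists>q'. steps q w q' \<and> traces q' \<subseteq> traces p')"
  then show "IF_le p q"
    unfolding IF_le_def impossible_futures_def by blast
qed

text \<open>Splits off the empty word, which reaches only \<open>p\<close> and \<open>q\<close>
  themselves. The matching \<open>q1\<close> may depend on \<open>w\<close> and \<open>p'\<close>,
  so this is weaker than a simulation.\<close>

lemma IF_le_iff_step:
  "IF_le p q \<longleftrightarrow> traces q \<subseteq> traces p \<and>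
     (\<forall>a w p1 p'. step p a p1 \<longrightarrow> steps p1 w p' \<longrightarrow>
        (\<exists>q1 q'. step q a q1 \<and> steps q1 w q' \<and> traces q' \<subseteq> traces p'))"
  (is "_ \<longleftrightarrow> ?T \<and> ?S")
proof
  assume le: "IF_le p q"
  have ?T
    using le[unfolded IF_le_iff, rule_format, of "[]"] by simp
  moreover have ?S
  proof (intro allI impI)
    fix a w p1 p' assume "step p a p1" "steps p1 w p'"
    then show "\<exists>q1 q'. step q a q1 \<and> steps q1 w q' \<and> traces q' \<subseteq> traces p'"
      using le[unfolded IF_le_iff, rule_format, of "a # w" p'] by auto
  qed
  ultimately show "?T \<and> ?S" ..
next
  assume TS: "?T \<and> ?S"
  show "IF_le p q"
    unfolding IF_le_iff
  proof (intro allI impI)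
    fix w p' assume w: "steps p w p'"
    show "\<exists>q'. steps q w q' \<and> traces q' \<subseteq> traces p'"
    proof (cases w)
      case Nil
      then show ?thesis using TS w by simp
    next
      case (Cons a v)
      then show ?thesis using TS w by fastforce
    qed
  qed
qed

section \<open>Soundness\<close>

abbreviation IF_axioms :: "('a bccsp \<times> 'a bccsp) set" where
  "IF_axioms \<equiv> A1 \<union> A2 \<union> A3 \<union> A4 \<union> IF1 \<union> IF2"

lemma IF_le_refl: "IF_le t t"
  by (simp add: IF_le_def)

lemma IF_le_trans: "IF_le t u \<Longrightarrow> IF_le u v \<Longrightarrow> IF_le t v"
  by (auto simp: IF_le_def)

lemma IF_le_Pref:
  assumes "IF_le t u"
  shows "IF_le (a \<cdot> t) (a \<cdot> u)"
proof -
  have "traces u \<subseteq> traces t"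
    using assms by (simp add: IF_le_iff_step)
  then show ?thesis
    using assms by (subst IF_le_iff_step) (auto simp: IF_le_iff)
qed

lemma IF_le_Alt:
  assumes "IF_le t u" "IF_le t' u'"
  shows "IF_le (t \<oplus> t') (u \<oplus> u')"
  using assms unfolding IF_le_iff_step by simp blast

lemma subst_subst: "subst \<tau> (subst \<sigma> t) = subst (\<lambda>x. subst \<tau> (\<sigma> x)) t"
  by (induction t) auto

lemma vars_subst: "vars (subst \<sigma> t) = (\<Union>x\<in>vars t. vars (\<sigma> x))"
  by (induction t) auto

lemma closed_term_subst: "closed_subst \<sigma> \<Longrightarrow> closed_term (subst \<sigma> t)"
  by (simp add: closed_term_def closed_subst_def vars_subst)

text \<open>Covers A1 to A4 and the direction of IF2 that adds a summand: every initial transition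
  matches itself, so only the empty word leaves a condition.\<close>

lemma IF_le_if_step_subset:
  assumes "traces q \<subseteq> traces p" "\<And>a s. step p a s \<Longrightarrow> step q a s"
  shows "IF_le p q"
  using assms by (subst IF_le_iff_step) blast

lemma IF_le_IF1: "IF_le (a \<cdot> (x \<oplus> y)) (a \<cdot> x \<oplus> a \<cdot> y)"
  unfolding IF_le_iff_step
proof (intro conjI allI impI)
  show "traces (a \<cdot> x \<oplus> a \<cdot> y) \<subseteq> traces (a \<cdot> (x \<oplus> y))" by auto
  fix b w p1 p' assume p: "step (a \<cdot> (x \<oplus> y)) b p1" "steps p1 w p'"
  \<comment> \<open>For empty \<open>w\<close> the target is \<open>x \<oplus> y\<close>, and
    \<open>x\<close> has fewer traces; a nonempty path starts in \<open>x\<close> or in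
    \<open>y\<close>.\<close>
  then have "(\<exists>q'. steps x w q' \<and> traces q' \<subseteq> traces p') \<or>
      (\<exists>q'. steps y w q' \<and> traces q' \<subseteq> traces p')"
    by (cases w) auto
  moreover have "step (a \<cdot> x \<oplus> a \<cdot> y) b x" "step (a \<cdot> x \<oplus> a \<cdot> y) b y" using p(1) by auto
  ultimately show "\<exists>q1 q'. step (a \<cdot> x \<oplus> a \<cdot> y) b q1 \<and> steps q1 w q' \<and> traces q' \<subseteq> traces p'"
    by blast
qed

lemma IF_le_IF2:
  "IF_le (a \<cdot> (x \<oplus> y) \<oplus> a \<cdot> x \<oplus> a \<cdot> (y \<oplus> z)) (a \<cdot> x \<oplus> a \<cdot> (y \<oplus> z))"
  (is "IF_le ?p ?q")
  unfolding IF_le_iff_step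
proof (intro conjI allI impI)
  show "traces ?q \<subseteq> traces ?p" by auto
  fix b w p1 p' assume p: "step ?p b p1" "steps p1 w p'"
  show "\<exists>q1 q'. step ?q b q1 \<and> steps q1 w q' \<and> traces q' \<subseteq> traces p'"
  proof (cases "p1 = x \<oplus> y")
    case True
    \<comment> \<open>Only the derivative \<open>x \<oplus> y\<close> is missing from
      \<open>?q\<close>. For empty \<open>w\<close>, \<open>x\<close> serves; otherwise the path
      starts in \<open>x\<close>, or in \<open>y\<close> and hence in
      \<open>y \<oplus> z\<close>.\<close>
    have "(\<exists>q'. steps x w q' \<and> traces q' \<subseteq> traces p') \<or>
        (\<exists>q'. steps (y \<oplus> z) w q' \<and> traces q' \<subseteq> traces p')"
      using p(2) True by (cases w) auto
    moreover have "step ?q b x" "step ?q b (y \<oplus> z)" using p(1) by auto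
    ultimately show ?thesis by blast
  next
    case False
    then have "step ?q b p1" using p(1) by auto
    then show ?thesis using p(2) by blast
  qed
qed

lemma IF_axioms_sound:
  fixes t u :: "'a bccsp"
  assumes "(t, u) \<in> IF_axioms"
  shows "IF_le (subst \<sigma> t) (subst \<sigma> u)"
proof -
  \<comment> \<open>The trace condition for A4: \<open>Zero\<close> contributes the empty trace
    alone.\<close>
  have "traces (Zero :: 'a bccsp) \<subseteq> traces (\<sigma> 0)"
  proof
    show "w \<in> traces (\<sigma> 0)" if "w \<in> traces (Zero :: 'a bccsp)" for w
      using that by (cases w) (auto simp: traces_iff)
  qed
  then show ?thesis
    using assms
    unfolding A1_def A2_def A3_def A4_def IF1_def IF2_def equation_def
    by (elim UnE UN_E insertE emptyE)
       (simp_all add: IF_le_IF1 IF_le_IF2, (rule IF_le_if_step_subset; auto)+)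
qed

lemma derivable_sound: "derivable IF_axioms t u \<Longrightarrow> IF_le_open t u"
proof (induction rule: derivable.induct)
  case (derivable_subst t u \<sigma>)
  \<comment> \<open>Following \<open>\<sigma>\<close> by a closed substitution gives a closed
    substitution, to which the induction hypothesis applies.\<close>
  then show ?case
    by (simp add: IF_le_open_def subst_subst closed_subst_def closed_term_subst)
next
  case (derivable_trans t u v)
  then show ?case unfolding IF_le_open_def using IF_le_trans by metis
qed (simp_all add: IF_le_open_def IF_axioms_sound IF_le_refl IF_le_Pref IF_le_Alt)

section \<open>Derivations up to associativity, commutativity and idempotence\<close>

abbreviation leq :: "'a bccsp \<Rightarrow> 'a bccsp \<Rightarrow> bool"  (infix "\<preceq>" 50) where
  "t \<preceq> u \<equiv> derivable IF_axioms t u"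

declare derivable_refl [simp] derivable_trans [trans]

lemma axiom_instance:
  "(t, u) \<in> IF_axioms \<Longrightarrow> subst \<sigma> t \<preceq> subst \<sigma> u"
  by (intro derivable_subst derivable_axiom)

lemma axiom_instances:
  "x \<oplus> y \<preceq> y \<oplus> x"
  "(x \<oplus> y) \<oplus> z \<preceq> x \<oplus> (y \<oplus> z)"
  "x \<oplus> (y \<oplus> z) \<preceq> (x \<oplus> y) \<oplus> z"
  "x \<oplus> x \<preceq> x"
  "x \<preceq> x \<oplus> x"
  "x \<oplus> Zero \<preceq> x"
  "x \<preceq> x \<oplus> Zero"
  "a \<cdot> (x \<oplus> y) \<preceq> a \<cdot> x \<oplus> a \<cdot> y"
  "a \<cdot> x \<oplus> a \<cdot> (y \<oplus> z) \<preceq> a \<cdot> (x \<oplus> y) \<oplus> a \<cdot> x \<oplus> a \<cdot> (y \<oplus> z)"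
  "a \<cdot> (x \<oplus> y) \<oplus> a \<cdot> x \<oplus> a \<cdot> (y \<oplus> z) \<preceq> a \<cdot> x \<oplus> a \<cdot> (y \<oplus> z)"
proof -
  let ?\<sigma> = "\<lambda>n::nat. if n = 0 then x else if n = 1 then y else z"
  note inst = axiom_instance[where \<sigma> = ?\<sigma>]
  note defs = A1_def A2_def A3_def A4_def IF1_def IF2_def equation_def
  show "x \<oplus> y \<preceq> y \<oplus> x"
    using inst[of "X \<oplus> Y" "Y \<oplus> X"] by (simp add: defs)
  show "(x \<oplus> y) \<oplus> z \<preceq> x \<oplus> (y \<oplus> z)"
    using inst[of "(X \<oplus> Y) \<oplus> Z" "X \<oplus> (Y \<oplus> Z)"] by (simp add: defs)
  show "x \<oplus> (y \<oplus> z) \<preceq> (x \<oplus> y) \<oplus> z"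
    using inst[of "X \<oplus> (Y \<oplus> Z)" "(X \<oplus> Y) \<oplus> Z"] by (simp add: defs)
  show "x \<oplus> x \<preceq> x"
    using inst[of "X \<oplus> X" X] by (simp add: defs)
  show "x \<preceq> x \<oplus> x"
    using inst[of X "X \<oplus> X"] by (simp add: defs)
  show "x \<oplus> Zero \<preceq> x"
    using inst[of "X \<oplus> Zero" X] by (simp add: defs)
  show "x \<preceq> x \<oplus> Zero"
    using inst[of X "X \<oplus> Zero"] by (simp add: defs)
  show "a \<cdot> (x \<oplus> y) \<preceq> a \<cdot> x \<oplus> a \<cdot> y"
    using inst[of "a \<cdot> (X \<oplus> Y)" "a \<cdot> X \<oplus> a \<cdot> Y"] by (simp add: defs)
  show "a \<cdot> x \<oplus> a \<cdot> (y \<oplus> z) \<preceq> a \<cdot> (x \<oplus> y) \<oplus> a \<cdot> x \<oplus> a \<cdot> (y \<oplus> z)"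
    using inst[of "a \<cdot> X \<oplus> a \<cdot> (Y \<oplus> Z)" "a \<cdot> (X \<oplus> Y) \<oplus> a \<cdot> X \<oplus> a \<cdot> (Y \<oplus> Z)"]
    by (simp add: defs)
  show "a \<cdot> (x \<oplus> y) \<oplus> a \<cdot> x \<oplus> a \<cdot> (y \<oplus> z) \<preceq> a \<cdot> x \<oplus> a \<cdot> (y \<oplus> z)"
    using inst[of "a \<cdot> (X \<oplus> Y) \<oplus> a \<cdot> X \<oplus> a \<cdot> (Y \<oplus> Z)" "a \<cdot> X \<oplus> a \<cdot> (Y \<oplus> Z)"]
    by (simp add: defs)
qed

lemmas comm_leq = axiom_instances(1)
lemmas assoc_leq = axiom_instances(2)
lemmas assoc_geq = axiom_instances(3)
lemmas idem_leq = axiom_instances(4)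
lemmas idem_geq = axiom_instances(5)
lemmas Zero_leq = axiom_instances(6)
lemmas Zero_geq = axiom_instances(7)
lemmas IF1_leq = axiom_instances(8)
lemmas IF2_leq = axiom_instances(9)
lemmas IF2_geq = axiom_instances(10)

lemma Alt_mono: "t \<preceq> u \<Longrightarrow> t' \<preceq> u' \<Longrightarrow> t \<oplus> t' \<preceq> u \<oplus> u'"
  by (rule derivable_trans[OF derivable_Alt1 derivable_Alt2])

primrec summands :: "'a bccsp \<Rightarrow> 'a bccsp set" where
  "summands Zero = {}"
| "summands (Var x) = {Var x}"
| "summands (a \<cdot> t) = {a \<cdot> t}"
| "summands (t \<oplus> u) = summands t \<union> summands u"

lemma step_iff_summand: "step p a p' \<longleftrightarrow> a \<cdot> p' \<in> summands p"
  by (induction p) auto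

text \<open>A3 applied to a copy of \<open>r\<close> deep inside \<open>u\<close>: associativity and
  commutativity carry the outer \<open>r\<close> to that copy.\<close>

lemma Alt_summand: "r \<in> summands u \<Longrightarrow> u \<oplus> r \<preceq> u \<and> u \<preceq> u \<oplus> r"
proof (induction u)
  case (Alt u v)
  have swap: "(x \<oplus> y) \<oplus> z \<preceq> (x \<oplus> z) \<oplus> y" for x y z :: "'a bccsp"
  proof -
    have "(x \<oplus> y) \<oplus> z \<preceq> x \<oplus> (y \<oplus> z)" by (rule assoc_leq)
    also have "\<dots> \<preceq> x \<oplus> (z \<oplus> y)" by (intro derivable_Alt2 comm_leq)
    also have "\<dots> \<preceq> (x \<oplus> z) \<oplus> y" by (rule assoc_geq)
    finally show ?thesis .
  qed
  show ?case
  proof (cases "r \<in> summands v")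
    case True
    then have r: "v \<oplus> r \<preceq> v" "v \<preceq> v \<oplus> r" using Alt by auto
    show ?thesis
      using derivable_trans[OF assoc_leq derivable_Alt2[OF r(1)]]
        derivable_trans[OF derivable_Alt2[OF r(2)] assoc_geq] by simp
  next
    case False
    then have r: "u \<oplus> r \<preceq> u" "u \<preceq> u \<oplus> r" using Alt by auto
    show ?thesis
      using derivable_trans[OF swap derivable_Alt1[OF r(1)]]
        derivable_trans[OF derivable_Alt1[OF r(2)] swap] by simp
  qed
qed (auto intro: idem_leq idem_geq)

lemma Alt_absorbI:
  assumes "\<And>r. r \<in> summands t \<Longrightarrow> u \<oplus> r \<preceq> u"
  shows "u \<oplus> t \<preceq> u"
  using assms
proof (induction t)
  case (Alt t1 t2)
  have "u \<oplus> (t1 \<oplus> t2) \<preceq> (u \<oplus> t1) \<oplus> t2" by (rule assoc_geq)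
  also have "\<dots> \<preceq> u \<oplus> t2" using Alt by (intro derivable_Alt1) simp
  also have "\<dots> \<preceq> u" using Alt by simp
  finally show ?case .
qed (auto intro: Zero_leq)

lemma leq_AltI:
  assumes "\<And>r. r \<in> summands t \<Longrightarrow> u \<preceq> u \<oplus> r"
  shows "u \<preceq> u \<oplus> t"
  using assms
proof (induction t)
  case (Alt t1 t2)
  have "u \<preceq> u \<oplus> t2" using Alt by simp
  also have "\<dots> \<preceq> (u \<oplus> t1) \<oplus> t2" using Alt by (intro derivable_Alt1) simp
  also have "\<dots> \<preceq> u \<oplus> (t1 \<oplus> t2)" by (rule assoc_leq)
  finally show ?case .
qed (auto intro: Zero_geq)

text \<open>Each term absorbs the summands of the other. This reduces regrouping, copying and
  merging of summands to an equality of sets.\<close>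

lemma leq_if_summands_eq:
  assumes "summands t = summands u"
  shows "t \<preceq> u"
proof -
  have "t \<preceq> t \<oplus> u" by (rule leq_AltI) (simp add: assms Alt_summand)
  also have "\<dots> \<preceq> u \<oplus> t" by (rule comm_leq)
  also have "\<dots> \<preceq> u" by (rule Alt_absorbI) (simp add: assms Alt_summand)
  finally show ?thesis .
qed

text \<open>Reduces the absorption of a closed sum to prefixed terms; the size bound drives the
  induction in \<open>absorb_if_matched\<close>.\<close>

lemma closed_summandE:
  assumes "r \<in> summands p" "closed_term p"
  obtains a t where "r = a \<cdot> t" "closed_term t" "size t < size p"
proof -
  have "\<exists>a t. r = a \<cdot> t \<and> closed_term t \<and> size t < size p"
    using assms
  proof (induction p)
    case (Alt t u)
    then have "(\<exists>a s. r = a \<cdot> s \<and> closed_term s \<and> size s < size t) \<or>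
        (\<exists>a s. r = a \<cdot> s \<and> closed_term s \<and> size s < size u)"
      by (auto simp: closed_term_def)
    then show ?case by (auto intro: less_trans)
  qed (auto simp: closed_term_def)
  then show thesis using that by blast
qed

lemma closed_step: "step p a p' \<Longrightarrow> closed_term p \<Longrightarrow> closed_term p'"
  by (induction p) (auto simp: closed_term_def)

section \<open>Ground-completeness\<close>

text \<open>The sums for the two sides of an \<open>\<oplus>\<close> merge by IF2. \<open>s\<close>
  is described by its transitions alone, which is what the later trace and matching arguments use. A
  derivative must exist, since otherwise \<open>p\<close> would gain a new
  \<open>a\<close>-step.\<close>

lemma absorb_sum_of_derivatives:
  assumes "step p a p0" "closed_term p"
  obtains s where "closed_term s" "p \<preceq> p \<oplus> a \<cdot> s" "p \<oplus> a \<cdot> s \<preceq> p"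
    "\<forall>c s'. step s c s' \<longleftrightarrow> (\<exists>p1. step p a p1 \<and> step p1 c s')"
proof -
  have "\<exists>s. closed_term s \<and> p \<preceq> p \<oplus> a \<cdot> s \<and> p \<oplus> a \<cdot> s \<preceq> p \<and>
      (\<forall>c s'. step s c s' \<longleftrightarrow> (\<exists>p1. step p a p1 \<and> step p1 c s'))"
    (is "\<exists>s. ?P p s")
    using assms
  proof (induction p arbitrary: p0)
    case (Pref b t)
    then show ?case
      by (intro exI[of _ t]) (auto simp: closed_term_def intro: idem_leq idem_geq)
  next
    case (Alt t u)
    have cl: "closed_term t" "closed_term u"
      using Alt.prems by (auto simp: closed_term_def)
    show ?case
    proof (cases "(\<exists>t0. step t a t0) \<and> (\<exists>u0. step u a u0)")
      case True
      then obtain s1 s2 where s1: "?P t s1" and s2: "?P u s2"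
        using Alt.IH cl by blast
      \<comment> \<open>IF2 with \<open>s2\<close> for both \<open>y\<close> and \<open>z\<close>;
        A3 doubles \<open>s2\<close> beforehand and collapses it afterwards.\<close>
      have merge_geq: "a \<cdot> s1 \<oplus> a \<cdot> s2 \<preceq> a \<cdot> (s1 \<oplus> s2) \<oplus> a \<cdot> s1 \<oplus> a \<cdot> s2"
        by (rule derivable_trans[OF derivable_trans[OF _ IF2_leq[of a s1 s2 s2]]])
           (intro Alt_mono derivable_Pref derivable_refl idem_leq idem_geq)+
      have merge_leq: "a \<cdot> (s1 \<oplus> s2) \<oplus> a \<cdot> s1 \<oplus> a \<cdot> s2 \<preceq> a \<cdot> s1 \<oplus> a \<cdot> s2"
        by (rule derivable_trans[OF derivable_trans[OF _ IF2_geq[of a s1 s2 s2]]])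
           (intro Alt_mono derivable_Pref derivable_refl idem_leq idem_geq)+
      have "t \<oplus> u \<preceq> (t \<oplus> a \<cdot> s1) \<oplus> (u \<oplus> a \<cdot> s2)"
        using s1 s2 by (intro Alt_mono) auto
      also have "\<dots> \<preceq> (t \<oplus> u) \<oplus> (a \<cdot> s1 \<oplus> a \<cdot> s2)"
        by (rule leq_if_summands_eq) auto
      also have "\<dots> \<preceq> (t \<oplus> u) \<oplus> (a \<cdot> (s1 \<oplus> s2) \<oplus> a \<cdot> s1 \<oplus> a \<cdot> s2)"
        by (intro derivable_Alt2 merge_geq)
      also have "\<dots> \<preceq> ((t \<oplus> a \<cdot> s1) \<oplus> (u \<oplus> a \<cdot> s2)) \<oplus> a \<cdot> (s1 \<oplus> s2)"
        by (rule leq_if_summands_eq) auto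
      also have "\<dots> \<preceq> (t \<oplus> u) \<oplus> a \<cdot> (s1 \<oplus> s2)"
        using s1 s2 by (intro derivable_Alt1 Alt_mono) auto
      finally have geq: "t \<oplus> u \<preceq> (t \<oplus> u) \<oplus> a \<cdot> (s1 \<oplus> s2)" .
      have "(t \<oplus> u) \<oplus> a \<cdot> (s1 \<oplus> s2) \<preceq> ((t \<oplus> a \<cdot> s1) \<oplus> (u \<oplus> a \<cdot> s2)) \<oplus> a \<cdot> (s1 \<oplus> s2)"
        using s1 s2 by (intro derivable_Alt1 Alt_mono) auto
      also have "\<dots> \<preceq> (t \<oplus> u) \<oplus> (a \<cdot> (s1 \<oplus> s2) \<oplus> a \<cdot> s1 \<oplus> a \<cdot> s2)"
        by (rule leq_if_summands_eq) auto
      also have "\<dots> \<preceq> (t \<oplus> u) \<oplus> (a \<cdot> s1 \<oplus> a \<cdot> s2)"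
        by (intro derivable_Alt2 merge_leq)
      also have "\<dots> \<preceq> (t \<oplus> a \<cdot> s1) \<oplus> (u \<oplus> a \<cdot> s2)"
        by (rule leq_if_summands_eq) auto
      also have "\<dots> \<preceq> t \<oplus> u"
        using s1 s2 by (intro Alt_mono) auto
      finally have leq: "(t \<oplus> u) \<oplus> a \<cdot> (s1 \<oplus> s2) \<preceq> t \<oplus> u" .
      have "closed_term (s1 \<oplus> s2)"
        using s1 s2 by (simp add: closed_term_def)
      then show ?thesis
        using s1 s2 geq leq by (intro exI[of _ "s1 \<oplus> s2"]) auto
    next
      case False
      \<comment> \<open>Exactly one side has \<open>a\<close>-derivatives, and its sum serves for
        \<open>t \<oplus> u\<close> as well.\<close>
      show ?thesis
      proof (cases "\<exists>t0. step t a t0")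
        case True
        then obtain s where s: "?P t s" using Alt.IH cl by blast
        have "t \<oplus> u \<preceq> (t \<oplus> a \<cdot> s) \<oplus> u" using s by (intro derivable_Alt1) auto
        also have "\<dots> \<preceq> (t \<oplus> u) \<oplus> a \<cdot> s" by (rule leq_if_summands_eq) auto
        finally have geq: "t \<oplus> u \<preceq> (t \<oplus> u) \<oplus> a \<cdot> s" .
        have "(t \<oplus> u) \<oplus> a \<cdot> s \<preceq> (t \<oplus> a \<cdot> s) \<oplus> u" by (rule leq_if_summands_eq) auto
        also have "\<dots> \<preceq> t \<oplus> u" using s by (intro derivable_Alt1) auto
        finally show ?thesis using s geq True False by (intro exI[of _ s]) auto
      next
        case nt: False
        then have "step u a p0" using Alt.prems by auto
        then obtain s where s: "?P u s" using Alt.IH cl by blast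
        have "t \<oplus> u \<preceq> t \<oplus> (u \<oplus> a \<cdot> s)" using s by (intro derivable_Alt2) auto
        also have "\<dots> \<preceq> (t \<oplus> u) \<oplus> a \<cdot> s" by (rule assoc_geq)
        finally have geq: "t \<oplus> u \<preceq> (t \<oplus> u) \<oplus> a \<cdot> s" .
        have "(t \<oplus> u) \<oplus> a \<cdot> s \<preceq> t \<oplus> (u \<oplus> a \<cdot> s)" by (rule assoc_leq)
        also have "\<dots> \<preceq> t \<oplus> u" using s by (intro derivable_Alt2) auto
        finally show ?thesis using s geq nt by (intro exI[of _ s]) auto
      qed
    qed
  qed auto
  then show thesis using that by blast
qed

text \<open>The induction on \<open>q\<close> ranges over all \<open>p\<close>, because below a
  prefix the comparison is with the sum \<open>s\<close> of derivatives: a single derivative of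
  \<open>p\<close> need not have all the traces required.\<close>

lemma leq_Alt_if_traces_subset:
  assumes "closed_term q" "closed_term p" "traces q \<subseteq> traces p"
  shows "p \<preceq> p \<oplus> q"
  using assms
proof (induction q arbitrary: p)
  case Zero
  show ?case by (rule Zero_geq)
next
  case (Var x)
  then show ?case by (simp add: closed_term_def)
next
  case (Pref a q)
  have cq: "closed_term q" using Pref.prems by (simp add: closed_term_def)
  have "[a] \<in> traces p" using Pref.prems traces_iff(1)[of q] by auto
  then obtain p0 where "step p a p0" by (auto simp: traces_iff)
  then obtain s where s: "closed_term s" "p \<preceq> p \<oplus> a \<cdot> s" "p \<oplus> a \<cdot> s \<preceq> p"
    and st: "\<forall>c s'. step s c s' \<longleftrightarrow> (\<exists>p1. step p a p1 \<and> step p1 c s')"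
    using Pref.prems(2) by (rule absorb_sum_of_derivatives)
  have "traces q \<subseteq> traces s"
  proof
    fix w assume w: "w \<in> traces q"
    then have "a # w \<in> traces p" using Pref.prems by auto
    then show "w \<in> traces s" by (cases w) (auto simp: traces_iff st)
  qed
  then have sq: "s \<preceq> s \<oplus> q" using Pref.IH cq s(1) by blast
  have "p \<preceq> p \<oplus> a \<cdot> s" by (rule s)
  also have "\<dots> \<preceq> p \<oplus> a \<cdot> (s \<oplus> q)" by (intro derivable_Alt2 derivable_Pref sq)
  also have "\<dots> \<preceq> p \<oplus> (a \<cdot> s \<oplus> a \<cdot> q)" by (intro derivable_Alt2 IF1_leq)
  also have "\<dots> \<preceq> (p \<oplus> a \<cdot> s) \<oplus> a \<cdot> q" by (rule assoc_geq)
  also have "\<dots> \<preceq> p \<oplus> a \<cdot> q" by (intro derivable_Alt1 s)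
  finally show ?case .
next
  case (Alt q1 q2)
  have "p \<preceq> p \<oplus> q2" using Alt by (auto simp: closed_term_def)
  also have "\<dots> \<preceq> (p \<oplus> q1) \<oplus> q2"
    using Alt by (intro derivable_Alt1) (auto simp: closed_term_def)
  also have "\<dots> \<preceq> p \<oplus> (q1 \<oplus> q2)" by (rule assoc_leq)
  finally show ?case .
qed

text \<open>The hypothesis asks for matching only and not for \<open>IF_le (a \<cdot> p) q\<close>:
  the induction replaces \<open>q\<close> by \<open>s\<close> and \<open>a \<cdot> p\<close> by one
  summand of \<open>p\<close>, whose traces need not include those of \<open>s\<close>.\<close>

lemma absorb_if_matched:
  assumes "closed_term p" "closed_term q"
    and "\<And>w p'. steps p w p' \<Longrightarrow>
           \<exists>q1 q'. step q a q1 \<and> steps q1 w q' \<and> traces q' \<subseteq> traces p'"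
  shows "q \<oplus> a \<cdot> p \<preceq> q"
  using assms
proof (induction "size p" arbitrary: p q a rule: less_induct)
  case less
  note matched = less.prems(3)
  obtain q0 where q0: "step q a q0" "traces q0 \<subseteq> traces p"
    using matched[of "[]" p] by auto
  have cq0: "closed_term q0" using q0(1) less.prems(2) by (rule closed_step)
  obtain s where s: "closed_term s" "q \<preceq> q \<oplus> a \<cdot> s" "q \<oplus> a \<cdot> s \<preceq> q"
    and st: "\<forall>c s'. step s c s' \<longleftrightarrow> (\<exists>q1. step q a q1 \<and> step q1 c s')"
    using q0(1) less.prems(2) by (rule absorb_sum_of_derivatives)
  have sp: "s \<oplus> p \<preceq> s"
  proof (rule Alt_absorbI)
    fix r assume r: "r \<in> summands p"
    then obtain b p1 where b: "r = b \<cdot> p1" "closed_term p1" "size p1 < size p"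
      using less.prems(1) by (rule closed_summandE)
    have "step p b p1" using r b(1) by (simp add: step_iff_summand)
    \<comment> \<open>A path of \<open>p1\<close> preceded by \<open>b\<close> is a path of
      \<open>p\<close>. In its match, the derivative of \<open>q\<close> after \<open>a\<close>
      performs \<open>b\<close>, and by \<open>st\<close> so does \<open>s\<close>.\<close>
    have "s \<oplus> b \<cdot> p1 \<preceq> s"
    proof (rule less.hyps[OF b(3,2) s(1)])
      fix w p' assume "steps p1 w p'"
      then have "steps p (b # w) p'" using \<open>step p b p1\<close> by auto
      then show "\<exists>q1 q'. step s b q1 \<and> steps q1 w q' \<and> traces q' \<subseteq> traces p'"
        using matched[of "b # w" p'] st by auto
    qed
    then show "s \<oplus> r \<preceq> s" using b(1) by simp
  qed
  \<comment> \<open>Only the word matters here: the match follows the same \<open>w\<close> from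
    some \<open>a\<close>-derivative of \<open>q\<close>.\<close>
  have "traces p \<subseteq> traces s"
  proof
    fix w assume "w \<in> traces p"
    then obtain p' where "steps p w p'" by (auto simp: traces_def)
    then obtain q1 q' where "step q a q1" "steps q1 w q'" using matched by blast
    then have "step q a q1" "w \<in> traces q1" by (auto simp: traces_def)
    then show "w \<in> traces s" by (cases w) (auto simp: traces_iff st)
  qed
  then have ps: "s \<preceq> s \<oplus> p"
    using leq_Alt_if_traces_subset less.prems(1) s(1) by blast
  have pq0: "p \<preceq> p \<oplus> q0"
    using leq_Alt_if_traces_subset less.prems(1) cq0 q0(2) by blast
  \<comment> \<open>Allows a copy of \<open>a \<cdot> q0\<close> to be split off from
    \<open>q\<close> for IF2 and merged back afterwards.\<close>
  have q: "summands q = insert (a \<cdot> q0) (summands q)"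
    using q0(1) by (auto simp: step_iff_summand)
  have "q \<oplus> a \<cdot> p \<preceq> (q \<oplus> a \<cdot> s) \<oplus> a \<cdot> p" by (intro derivable_Alt1 s)
  \<comment> \<open>Produces the shape of IF2 with \<open>q0\<close>, \<open>p\<close>,
    \<open>s\<close> for \<open>x\<close>, \<open>y\<close>, \<open>z\<close>.\<close>
  also have "\<dots> \<preceq> (q \<oplus> a \<cdot> (p \<oplus> s)) \<oplus> a \<cdot> (q0 \<oplus> p)"
    by (intro Alt_mono derivable_refl derivable_Pref derivable_trans[OF ps comm_leq]
        derivable_trans[OF pq0 comm_leq])
  also have "\<dots> \<preceq> q \<oplus> (a \<cdot> (q0 \<oplus> p) \<oplus> a \<cdot> q0 \<oplus> a \<cdot> (p \<oplus> s))"
    by (rule leq_if_summands_eq) (use q in auto)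
  also have "\<dots> \<preceq> q \<oplus> (a \<cdot> q0 \<oplus> a \<cdot> (p \<oplus> s))"
    by (intro derivable_Alt2 IF2_geq)
  also have "\<dots> \<preceq> q \<oplus> a \<cdot> (p \<oplus> s)"
    by (rule leq_if_summands_eq) (use q in auto)
  also have "\<dots> \<preceq> q \<oplus> a \<cdot> s"
    by (intro derivable_Alt2 derivable_Pref derivable_trans[OF comm_leq sp])
  also have "\<dots> \<preceq> q" by (rule s)
  finally show ?case .
qed

text \<open>The conjuncts of \<open>IF_le_iff_step\<close> feed the two halves: trace inclusion adds
  \<open>q\<close> to \<open>p\<close>, and matching lets \<open>q\<close> absorb each summand of
  \<open>p\<close>.\<close>

lemma derivable_if_IF_le:
  assumes "closed_term p" "closed_term q" "IF_le p q"
  shows "p \<preceq> q"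
proof -
  have "p \<preceq> p \<oplus> q"
    using assms by (intro leq_Alt_if_traces_subset) (auto simp: IF_le_iff_step)
  also have "\<dots> \<preceq> q \<oplus> p" by (rule comm_leq)
  also have "\<dots> \<preceq> q"
  proof (rule Alt_absorbI)
    fix r assume r: "r \<in> summands p"
    then obtain a p1 where a: "r = a \<cdot> p1" "closed_term p1"
      using assms(1) by (rule closed_summandE)
    then have "step p a p1" using r by (simp add: step_iff_summand)
    then have "q \<oplus> a \<cdot> p1 \<preceq> q"
      using assms by (intro absorb_if_matched a) (auto simp: IF_le_iff_step)
    then show "q \<oplus> r \<preceq> q" using a by simp
  qed
  finally show ?thesis .
qed

theorem theorem5p1:
  shows "sound (A1 \<union> A2 \<union> A3 \<union> A4 \<union> IF1 \<union> IF2 :: ('a::countable bccsp \<times> 'a bccsp) set)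
       \<and> ground_complete (A1 \<union> A2 \<union> A3 \<union> A4 \<union> IF1 \<union> IF2 :: ('a bccsp \<times> 'a bccsp) set)"
  unfolding sound_def ground_complete_def
  using derivable_sound derivable_if_IF_le by blast

end
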